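(* Let $s=2$, $\mathfrak N\in\mathbb N$, let $\mathcal P_{\mathfrak N}=\{t_n\}_{n=0}^{\mathfrak N}$ be a partition of $[0,t_f]$ and $n\in\{0,\dots,\mathfrak N-1\}$. Assume $a_{11}>0$ and $a_{22}>0$. Then the solution of the two-stage DIRK scheme $$v_{n,1}=u_n+\tau_n a_{11}\mathscr F_{n,1},\qquad v_{n,2}=u_n+\tau_n(a_{21}\mathscr F_{n,1}+a_{22}\mathscr F_{n,2}),\qquad u_{n+1}=u_n+\tau_n(b_1\mathscr F_{n,1}+b_2\mathscr F_{n,2})$$ satisfies $$\tfrac12|u_{n+1}|^2+\delta_1|v_{n,1}-u_n|^2+\delta_2|v_{n,2}-v_{n,1}|^2-\tau_n\left[\nu_{11}\langle\mathscr F_{n,1},v_{n,1}\rangle+\nu_{22}\langle\mathscr F_{n,2},v_{n,2}\rangle\right]=\tfrac12|u_n|^2+\tau_n\nu_{12}\langle\mathscr F_{n,1},v_{n,2}\rangle,$$ where $$\lambda_1=\frac{b_1}{a_{11}}-\frac{b_2a_{21}}{a_{22}a_{11}},\qquad \lambda_2=\frac{b_2}{a_{22}},$$ $$\delta_1=\tfrac12(\lambda_1+\lambda_2)(2-\lambda_1-\lambda_2),\quad \delta_2=\tfrac12\lambda_2(2-\lambda_2),\quad \nu_{11}=a_{11}\left[\lambda_1(1-\lambda_2)+\lambda_2(2-\lambda_2)\right],$$ $$\nu_{22}=a_{22}\lambda_2,\quad \nu_{12}=\lambda_2\left[a_{21}+a_{11}(\lambda_1+\lambda_2-2)\right].$$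
   Context: $\mathbb V\subset\mathbb H\subset\mathbb V^*$ is a Gelfand triple: $\mathbb H$ is a separable (real) Hilbert space with inner product $(\cdot,\cdot)$ and norm $|\cdot|$; $\mathbb V$ is a Banach space with dual $\mathbb V^*$ and duality pairing $\langle\cdot,\cdot\rangle$; every $v\in\mathbb H$ is identified with the element of $\mathbb V^*$ given by $\langle v,w\rangle=(v,w)$ for all $w\in\mathbb V$. Let $t_f>0$, $u_0\in\mathbb H$, $f:[0,t_f]\to\mathbb V^*$ and $\mathcal A:\mathbb V\to\mathbb V^*$; the problem approximated is $\frac{du}{dt}=f(t)-\mathcal A(u)$ on $(0,t_f]$, $u(0)=u_0$. Standing assumptions on $\mathcal A$: $\langle\mathcal A(w),w\rangle\ge0$ for all $w\in\mathbb V$, and (local solvability) for every $F\in\mathbb V^*$ there is $\beta>0$ such that for all $\gamma\in(0,\beta]$ the problem $v+\gamma\mathcal A(v)=F$ has a unique solution $v\in\mathbb V$. A partition is $0=t_0<\dots<t_{\mathfrak N}=t_f$ and $\tau_n=t_{n+1}-t_n$. The Runge-Kutta scheme has tableau with coefficient matrix $\mathbf A=[a_{ij}]$ (lower triangular, i.e. DIRK), weights $b_i\in[0,1]$ and nodes $c_i\in[0,1]$. Here $\mathscr F_{n,j}=f(t_n+c_j\tau_n)-\mathcal A(v_{n,j})$. The scheme equations hold in $\mathbb V^*$, with $u_n\in\mathbb H$, stages $v_{n,i}\in\mathbb V$ and $u_{n+1}\in\mathbb H$. No order conditions on the tableau are assumed. *)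

theory Defs
  imports "HOL-Analysis.Analysis"
begin

text \<open>
  The Gelfand triple is given by its continuous, injective and dense embedding \<open>\<iota>\<close> of the Banach
  space \<open>'v\<close> into the real Hilbert space \<open>'h\<close>; the dual of \<open>'v\<close> is the type of bounded linear
  functionals \<open>'v \<Rightarrow>\<^sub>L real\<close>, and the duality pairing is function application.
\<close>

definition gelfand_triple ::
    "('v::banach \<Rightarrow>\<^sub>L 'h::{real_inner, complete_space, second_countable_topology}) \<Rightarrow> bool" where
  "gelfand_triple \<iota> \<longleftrightarrow> inj (blinfun_apply \<iota>) \<and> closure (range (blinfun_apply \<iota>)) = UNIV"

definition to_dual ::
    "('v::banach \<Rightarrow>\<^sub>L 'h::{real_inner, complete_space, second_countable_topology})
      \<Rightarrow> 'h \<Rightarrow> ('v \<Rightarrow>\<^sub>L real)" where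
  "to_dual \<iota> h = blinfun_inner_right h o\<^sub>L \<iota>"

lemma to_dual_apply: "to_dual \<iota> h w = h \<bullet> \<iota> w"
  by (simp add: to_dual_def)

definition locally_solvable ::
    "('v::banach \<Rightarrow>\<^sub>L 'h::{real_inner, complete_space, second_countable_topology})
      \<Rightarrow> ('v \<Rightarrow> ('v \<Rightarrow>\<^sub>L real)) \<Rightarrow> bool" where
  "locally_solvable \<iota> A \<longleftrightarrow>
    (\<forall>F. \<exists>\<beta>>0. \<forall>\<gamma>\<in>{0<..\<beta>}. \<exists>!v. to_dual \<iota> (\<iota> v) + \<gamma> *\<^sub>R A v = F)"

definition is_partition :: "(nat \<Rightarrow> real) \<Rightarrow> nat \<Rightarrow> real \<Rightarrow> bool" where
  "is_partition t N t\<^sub>f \<longleftrightarrow> t 0 = 0 \<and> t N = t\<^sub>f \<and> (\<forall>k<N. t k < t (Suc k))"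

text \<open>Tableau entries are indexed from 1; values at indices outside \<open>{1..s}\<close> are irrelevant.\<close>

definition dirk_tableau ::
    "nat \<Rightarrow> (nat \<Rightarrow> nat \<Rightarrow> real) \<Rightarrow> (nat \<Rightarrow> real) \<Rightarrow> (nat \<Rightarrow> real) \<Rightarrow> bool" where
  "dirk_tableau s a b c \<longleftrightarrow>
    (\<forall>i\<in>{1..s}. \<forall>j\<in>{1..s}. i < j \<longrightarrow> a i j = 0) \<and>
    (\<forall>i\<in>{1..s}. b i \<in> {0..1} \<and> c i \<in> {0..1})"

text \<open>
  The source term \<open>f\<close> lives on \<open>[0, t\<^sub>f]\<close>; it is a total function here, but since the nodes \<open>c j\<close> lie
  in \<open>[0, 1]\<close> it is only evaluated on that interval.
\<close>

definition stage_rhs ::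
    "(real \<Rightarrow> ('v::banach \<Rightarrow>\<^sub>L real)) \<Rightarrow> ('v \<Rightarrow> ('v \<Rightarrow>\<^sub>L real)) \<Rightarrow> (nat \<Rightarrow> real) \<Rightarrow> (nat \<Rightarrow> real)
      \<Rightarrow> (nat \<Rightarrow> nat \<Rightarrow> 'v) \<Rightarrow> nat \<Rightarrow> nat \<Rightarrow> ('v \<Rightarrow>\<^sub>L real)" where
  "stage_rhs f A t c v n j = f (t n + c j * (t (Suc n) - t n)) - A (v n j)"

end

theory Submission
  imports Defs
begin

text \<open>
  Eliminating the right-hand sides with the stage equations shows that \<open>u (Suc n) - u n\<close>, as an
  element of the dual space, is the image of \<open>(lam\<^sub>1 + lam\<^sub>2) p + lam\<^sub>2 q\<close> with \<open>p = v n 1 - u n\<close> and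
  \<open>q = v n 2 - v n 1\<close>. Since \<open>'v\<close> is dense in \<open>'h\<close>, the dual embedding is injective and this holds in
  \<open>'h\<close>. Both sides of the claim are then quadratic forms in \<open>u n\<close>, \<open>p\<close> and \<open>q\<close>, and their
  coefficients agree.
\<close>

lemma to_dual_add: "to_dual \<iota> (x + y) = to_dual \<iota> x + to_dual \<iota> y"
  by (rule blinfun_eqI) (simp add: to_dual_apply blinfun.add_left inner_add_left)

lemma to_dual_scaleR: "to_dual \<iota> (k *\<^sub>R x) = k *\<^sub>R to_dual \<iota> x"
  by (rule blinfun_eqI) (simp add: to_dual_apply blinfun.scaleR_left)

lemma to_dual_diff: "to_dual \<iota> (x - y) = to_dual \<iota> x - to_dual \<iota> y"
  by (rule blinfun_eqI) (simp add: to_dual_apply blinfun.diff_left inner_diff_left)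

text \<open>If \<open>x\<close> and \<open>y\<close> induce the same functional,
  \<open>x - y\<close> is orthogonal to the range of \<iota>. The hyperplane orthogonal to
  \<open>x - y\<close> is closed and contains this dense range, so it contains \<open>x - y\<close>
  itself.\<close>

lemma inj_to_dual:
  assumes "gelfand_triple \<iota>"
  shows "inj (to_dual \<iota>)"
proof (rule injI)
  fix x y assume eq: "to_dual \<iota> x = to_dual \<iota> y"
  have "range (blinfun_apply \<iota>) \<subseteq> {z. (x - y) \<bullet> z = 0}"
    using eq by (auto simp: inner_diff_left simp flip: to_dual_apply)
  then have "closure (range (blinfun_apply \<iota>)) \<subseteq> {z. (x - y) \<bullet> z = 0}"
    by (intro closure_minimal closed_hyperplane)
  with assms have "(x - y) \<bullet> (x - y) = 0"
    unfolding gelfand_triple_def by blast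
  then show "x = y" by simp
qed

text \<open>Here \<open>u + p\<close> and \<open>u + p + q\<close> play the two stages, and
  \<open>l\<close>, \<open>m\<close> are \<open>lam\<^sub>1\<close>, \<open>lam\<^sub>2\<close>. The
  inner products on the right are what the duality pairings become once the right-hand sides are
  eliminated.\<close>

lemma two_stage_energy_identity:
  fixes u p q :: "'a::real_inner" and l m :: real
  shows "1/2 * (norm (u + (l + m) *\<^sub>R p + m *\<^sub>R q))\<^sup>2
           + 1/2 * (l + m) * (2 - l - m) * (norm p)\<^sup>2 + 1/2 * m * (2 - m) * (norm q)\<^sup>2
         = 1/2 * (norm u)\<^sup>2 + (l * (1 - m) + m * (2 - m)) * (p \<bullet> (u + p))
           + m * ((p + q) \<bullet> (u + p + q)) + m * (l + m - 2) * (p \<bullet> (u + p + q))"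
  unfolding power2_norm_eq_inner
  \<comment> \<open>Orienting the three mixed products leaves six independent inner products of
    \<open>u\<close>, \<open>p\<close>, \<open>q\<close>; a polynomial identity in them
    remains.\<close>
  by (simp add: inner_add_left inner_add_right inner_commute[of p u] inner_commute[of q u]
      inner_commute[of q p]) (simp add: field_simps)

theorem theorem4p3:
  fixes \<iota> :: "'v::banach \<Rightarrow>\<^sub>L 'h::{real_inner, complete_space, second_countable_topology}"
    and A :: "'v \<Rightarrow> ('v \<Rightarrow>\<^sub>L real)"
    and f :: "real \<Rightarrow> ('v \<Rightarrow>\<^sub>L real)"
    and t\<^sub>f :: real and u\<^sub>0 :: 'h
    and N n :: nat and t \<tau> :: "nat \<Rightarrow> real"
    and a :: "nat \<Rightarrow> nat \<Rightarrow> real" and b c :: "nat \<Rightarrow> real"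
    and u :: "nat \<Rightarrow> 'h" and v :: "nat \<Rightarrow> nat \<Rightarrow> 'v"
    and F :: "nat \<Rightarrow> nat \<Rightarrow> ('v \<Rightarrow>\<^sub>L real)"
    and lam\<^sub>1 lam\<^sub>2 \<delta>\<^sub>1 \<delta>\<^sub>2 \<nu>\<^sub>1\<^sub>1 \<nu>\<^sub>2\<^sub>2 \<nu>\<^sub>1\<^sub>2 :: real
  assumes "gelfand_triple \<iota>"
    and "\<And>w. A w w \<ge> 0"
    and "locally_solvable \<iota> A"
    and "t\<^sub>f > 0"
    and "is_partition t N t\<^sub>f"
    and "n < N"
    and "\<And>k. \<tau> k = t (Suc k) - t k"
    and "dirk_tableau 2 a b c"
    and "a 1 1 > 0" and "a 2 2 > 0"
    and "\<And>k j. F k j = stage_rhs f A t c v k j"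
    and "u 0 = u\<^sub>0"
    and "to_dual \<iota> (\<iota> (v n 1)) = to_dual \<iota> (u n) + (\<tau> n * a 1 1) *\<^sub>R F n 1"
    and "to_dual \<iota> (\<iota> (v n 2)) = to_dual \<iota> (u n) + \<tau> n *\<^sub>R (a 2 1 *\<^sub>R F n 1 + a 2 2 *\<^sub>R F n 2)"
    and "to_dual \<iota> (u (Suc n)) = to_dual \<iota> (u n) + \<tau> n *\<^sub>R (b 1 *\<^sub>R F n 1 + b 2 *\<^sub>R F n 2)"
    and "lam\<^sub>1 = b 1 / a 1 1 - b 2 * a 2 1 / (a 2 2 * a 1 1)"
    and "lam\<^sub>2 = b 2 / a 2 2"
    and "\<delta>\<^sub>1 = 1/2 * (lam\<^sub>1 + lam\<^sub>2) * (2 - lam\<^sub>1 - lam\<^sub>2)"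
    and "\<delta>\<^sub>2 = 1/2 * lam\<^sub>2 * (2 - lam\<^sub>2)"
    and "\<nu>\<^sub>1\<^sub>1 = a 1 1 * (lam\<^sub>1 * (1 - lam\<^sub>2) + lam\<^sub>2 * (2 - lam\<^sub>2))"
    and "\<nu>\<^sub>2\<^sub>2 = a 2 2 * lam\<^sub>2"
    and "\<nu>\<^sub>1\<^sub>2 = lam\<^sub>2 * (a 2 1 + a 1 1 * (lam\<^sub>1 + lam\<^sub>2 - 2))"
  shows "1/2 * (norm (u (Suc n)))\<^sup>2 + \<delta>\<^sub>1 * (norm (\<iota> (v n 1) - u n))\<^sup>2
           + \<delta>\<^sub>2 * (norm (\<iota> (v n 2) - \<iota> (v n 1)))\<^sup>2
           - \<tau> n * (\<nu>\<^sub>1\<^sub>1 * F n 1 (v n 1) + \<nu>\<^sub>2\<^sub>2 * F n 2 (v n 2))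
         = 1/2 * (norm (u n))\<^sup>2 + \<tau> n * \<nu>\<^sub>1\<^sub>2 * F n 1 (v n 2)"
proof -
  define p q where "p = \<iota> (v n 1) - u n" and "q = \<iota> (v n 2) - \<iota> (v n 1)"
  let ?f1 = "\<tau> n *\<^sub>R F n 1" and ?f2 = "\<tau> n *\<^sub>R F n 2"
  have a1: "a 1 1 \<noteq> 0" and a2: "a 2 2 \<noteq> 0"
    using assms(9,10) by auto
  have y1: "\<iota> (v n 1) = u n + p" and y2: "\<iota> (v n 2) = u n + p + q"
    by (simp_all add: p_def q_def)
  have s1: "a 1 1 *\<^sub>R ?f1 = to_dual \<iota> p"
    using assms(13) by (simp add: p_def to_dual_diff mult.commute)
  have s2: "a 2 1 *\<^sub>R ?f1 + a 2 2 *\<^sub>R ?f2 = to_dual \<iota> (p + q)"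
    using assms(14) by (simp add: p_def q_def to_dual_diff scaleR_add_right mult.commute)
  \<comment> \<open>The lambdas solve the triangular system that writes the weights \<open>b\<close>
    as a combination of the two tableau rows, so the update is the same combination of the stage
    increments.\<close>
  have lam1: "b 1 = lam\<^sub>1 * a 1 1 + lam\<^sub>2 * a 2 1" and lam2: "b 2 = lam\<^sub>2 * a 2 2"
    unfolding assms(16,17) using a1 a2 by (simp_all add: field_simps)
  have "to_dual \<iota> (u (Suc n)) = to_dual \<iota> (u n) + lam\<^sub>1 *\<^sub>R (a 1 1 *\<^sub>R ?f1)
      + lam\<^sub>2 *\<^sub>R (a 2 1 *\<^sub>R ?f1 + a 2 2 *\<^sub>R ?f2)"
    unfolding assms(15) lam1 lam2 by (simp add: algebra_simps)
  also have "\<dots> = to_dual \<iota> (u n + (lam\<^sub>1 + lam\<^sub>2) *\<^sub>R p + lam\<^sub>2 *\<^sub>R q)"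
    unfolding s1 s2 by (simp add: to_dual_add to_dual_scaleR algebra_simps)
  finally have u': "u (Suc n) = u n + (lam\<^sub>1 + lam\<^sub>2) *\<^sub>R p + lam\<^sub>2 *\<^sub>R q"
    by (rule injD[OF inj_to_dual[OF assms(1)]])
  \<comment> \<open>The test vector \<open>w\<close> stays free because \<open>F n 1\<close> is
    paired with both stages.\<close>
  have f1: "a 1 1 * (\<tau> n * F n 1 w) = p \<bullet> \<iota> w" for w
    using arg_cong[OF s1, of "\<lambda>g. blinfun_apply g w"]
    by (simp add: to_dual_apply blinfun.scaleR_left)
  have f2: "a 2 1 * (\<tau> n * F n 1 w) + a 2 2 * (\<tau> n * F n 2 w) = (p + q) \<bullet> \<iota> w" for w
    using arg_cong[OF s2, of "\<lambda>g. blinfun_apply g w"]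
    by (simp add: to_dual_apply blinfun.scaleR_left blinfun.add_left)
  \<comment> \<open>Testing the second stage equation with \<open>v n 2\<close> also yields
    \<open>a 2 1\<close> times the pairing of \<open>F n 1\<close> with \<open>v n 2\<close>; this
    is the source of the \<open>a 2 1\<close> term in \<open>\<nu>\<^sub>1\<^sub>2\<close>.\<close>
  have "\<tau> n * (\<nu>\<^sub>1\<^sub>1 * F n 1 (v n 1) + \<nu>\<^sub>2\<^sub>2 * F n 2 (v n 2)) + \<tau> n * \<nu>\<^sub>1\<^sub>2 * F n 1 (v n 2)
      = (lam\<^sub>1 * (1 - lam\<^sub>2) + lam\<^sub>2 * (2 - lam\<^sub>2)) * (p \<bullet> \<iota> (v n 1))
        + lam\<^sub>2 * ((p + q) \<bullet> \<iota> (v n 2)) + lam\<^sub>2 * (lam\<^sub>1 + lam\<^sub>2 - 2) * (p \<bullet> \<iota> (v n 2))"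
    unfolding f1[symmetric] f2[symmetric] assms(20-22) by (simp add: algebra_simps)
  moreover have "1/2 * (norm (u (Suc n)))\<^sup>2 + \<delta>\<^sub>1 * (norm p)\<^sup>2 + \<delta>\<^sub>2 * (norm q)\<^sup>2
      = 1/2 * (norm (u n))\<^sup>2
        + (lam\<^sub>1 * (1 - lam\<^sub>2) + lam\<^sub>2 * (2 - lam\<^sub>2)) * (p \<bullet> \<iota> (v n 1))
        + lam\<^sub>2 * ((p + q) \<bullet> \<iota> (v n 2)) + lam\<^sub>2 * (lam\<^sub>1 + lam\<^sub>2 - 2) * (p \<bullet> \<iota> (v n 2))"
    unfolding u' y1 y2 assms(18,19) by (rule two_stage_energy_identity)
  ultimately show ?thesis
    unfolding p_def[symmetric] q_def[symmetric] by linarith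
qed

end
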